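(* Let $n$ be a power of $2$, $A\in\mathbb{R}^{n\times n}$, $W\in\{0,1\}^{n\times n}$, and let $f$ be the function computed by $W$. Let $k\ge1$, $\epsilon_1,\epsilon_2\in[0,1]$, $k'\ge k\cdot 2^{R_{\epsilon_1,\epsilon_2}(f)}$, $\Delta\ge0$, and let $\|\cdot\|_\star$ be any entrywise matrix norm. Then for any $L\in\mathbb{R}^{n\times n}$ satisfying $\|A\circ W-L\|_\star\le\min_{\text{rank-}k'\ \hat L}\|A\circ W-\hat L\|_\star+\Delta$, $$\|(A-L)\circ W\|_\star\le OPT+\epsilon_1\|A\circ W\|_\star+\epsilon_2\|L_{opt}\circ(1-W)\|_\star+\Delta,$$ where $OPT=\min_{\text{rank-}k\ \hat L}\|(A-\hat L)\circ W\|_\star$ and $L_{opt}$ is any rank-$k$ matrix achieving $OPT$.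
   Context: An entrywise matrix norm is a function $\|M\|_\star=\sum_{i,j}g(|M_{i,j}|)$ where $g:\mathbb{R}\to\mathbb{R}$ is monotonically increasing and nonnegative. $\circ$ is the entrywise product and $1-W$ has entries $1-W_{i,j}$. Rows and columns of $W$ are indexed by $x,y\in\{0,1\}^{\log n}$ and $f(x,y)=W_{x,y}$. In a public-coin randomized two-party protocol, Alice (holding $x$) and Bob (holding $y$) see a shared random string $r$ and then run a deterministic protocol $\Pi_r$; its cost is the maximum number of bits exchanged over inputs and $r$. It is a $(\delta_1,\delta_2)$-error protocol for $f$ if it outputs $f(x,y)$ with probability $\ge1-\delta_1$ on every input with $f(x,y)=1$ and with probability $\ge1-\delta_2$ on every input with $f(x,y)=0$. $R_{\delta_1,\delta_2}(f)$ is the minimum cost of such a protocol. *)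

theory Defs
  imports "HOL-Probability.Probability"
begin

section \<open>Entrywise operations on matrices\<close>

(* Multiplication on the vec type is componentwise, hence on real^'n^'m it is the entrywise
   product of matrices; the matrix product is written ** instead.  Likewise the constant 1 of that type is the
   all-ones matrix (the identity matrix is mat 1), so 1 - W has entries 1 - W $ i $ j. *)
abbreviation entrywise_prod :: "real^'n^'m \<Rightarrow> real^'n^'m \<Rightarrow> real^'n^'m"  (infixl \<open>\<odot>\<close> 70)
  where "A \<odot> B \<equiv> A * B"

lemma entrywise_prod_nth: "(A \<odot> B) $ i $ j = A $ i $ j * B $ i $ j"
  by simp

lemma one_minus_matrix_nth: "((1 :: real^'n^'m) - W) $ i $ j = 1 - W $ i $ j"
  by simp

definition entrywise_matrix_norm :: "(real^'n^'m \<Rightarrow> real) \<Rightarrow> bool" where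
  "entrywise_matrix_norm N \<longleftrightarrow>
     (\<exists>g :: real \<Rightarrow> real. mono g \<and> (\<forall>t. 0 \<le> g t) \<and>
        (\<forall>M. N M = (\<Sum>i\<in>UNIV. \<Sum>j\<in>UNIV. g \<bar>M $ i $ j\<bar>)))"


section \<open>Public-coin randomized communication protocols\<close>

(* A deterministic protocol is a binary tree: at an inner node one of the parties sends a bit
   computed from its own input (the history is the position in the tree; False continues in the
   first subtree, True in the second); a leaf carries the output, which is thus determined by
   the transcript. *)
datatype ('a, 'b) protocol =
    Output bool
  | Alice "'a \<Rightarrow> bool" "('a, 'b) protocol" "('a, 'b) protocol"
  | Bob "'b \<Rightarrow> bool" "('a, 'b) protocol" "('a, 'b) protocol"

primrec run :: "('a, 'b) protocol \<Rightarrow> 'a \<Rightarrow> 'b \<Rightarrow> bool" where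
  "run (Output z) x y = z"
| "run (Alice a P Q) x y = (if a x then run Q x y else run P x y)"
| "run (Bob b P Q) x y = (if b y then run Q x y else run P x y)"

primrec bits_sent :: "('a, 'b) protocol \<Rightarrow> 'a \<Rightarrow> 'b \<Rightarrow> nat" where
  "bits_sent (Output z) x y = 0"
| "bits_sent (Alice a P Q) x y = Suc (if a x then bits_sent Q x y else bits_sent P x y)"
| "bits_sent (Bob b P Q) x y = Suc (if b y then bits_sent Q x y else bits_sent P x y)"

(* A public-coin protocol is given by the distribution D of the shared random string r and by
   the deterministic protocols prot r.  X and Y are the sets of inputs of Alice and Bob. *)
definition error_protocol ::
  "'a set \<Rightarrow> 'b set \<Rightarrow> real \<Rightarrow> real \<Rightarrow> ('a \<Rightarrow> 'b \<Rightarrow> bool) \<Rightarrow>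
   bool list pmf \<Rightarrow> (bool list \<Rightarrow> ('a, 'b) protocol) \<Rightarrow> bool" where
  "error_protocol X Y \<delta>1 \<delta>2 f D prot \<longleftrightarrow>
     (\<forall>x\<in>X. \<forall>y\<in>Y.
        (f x y \<longrightarrow> measure_pmf.prob D {r. run (prot r) x y = f x y} \<ge> 1 - \<delta>1) \<and>
        (\<not> f x y \<longrightarrow> measure_pmf.prob D {r. run (prot r) x y = f x y} \<ge> 1 - \<delta>2))"

definition protocol_cost ::
  "'a set \<Rightarrow> 'b set \<Rightarrow> bool list pmf \<Rightarrow> (bool list \<Rightarrow> ('a, 'b) protocol) \<Rightarrow> enat" where
  "protocol_cost X Y D prot =
     (SUP r\<in>set_pmf D. SUP x\<in>X. SUP y\<in>Y. enat (bits_sent (prot r) x y))"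

definition rand_comm ::
  "'a set \<Rightarrow> 'b set \<Rightarrow> real \<Rightarrow> real \<Rightarrow> ('a \<Rightarrow> 'b \<Rightarrow> bool) \<Rightarrow> nat" where
  "rand_comm X Y \<delta>1 \<delta>2 f =
     (LEAST c. \<exists>D prot. error_protocol X Y \<delta>1 \<delta>2 f D prot \<and> protocol_cost X Y D prot = enat c)"

primrec depth :: "('a, 'b) protocol \<Rightarrow> nat" where
  "depth (Output z) = 0"
| "depth (Alice a P Q) = Suc (max (depth P) (depth Q))"
| "depth (Bob b P Q) = Suc (max (depth P) (depth Q))"

lemma bits_sent_le_depth: "bits_sent P x y \<le> depth P"
  by (induction P) (auto simp: le_max_iff_disj)

lemma ex_exact_protocol:
  assumes "finite X"
  shows "\<exists>P. \<forall>x\<in>X. \<forall>y. run P x y = f x y"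
  using assms
proof (induction X rule: finite_induct)
  case (insert a X)
  from insert.IH obtain P where "\<forall>x\<in>X. \<forall>y. run P x y = f x y" ..
  then have "\<forall>x\<in>insert a X. \<forall>y.
      run (Alice (\<lambda>x. x = a) P (Bob (f a) (Output False) (Output True))) x y = f x y"
    by simp
  then show ?case ..
qed simp

(* The minimum defining rand_comm exists in the intended range of parameters. *)
lemma rand_comm_attained:
  assumes "finite X" "0 \<le> \<delta>1" "0 \<le> \<delta>2"
  shows "\<exists>D prot. error_protocol X Y \<delta>1 \<delta>2 f D prot \<and>
           protocol_cost X Y D prot = enat (rand_comm X Y \<delta>1 \<delta>2 f)"
proof -
  obtain P where P: "\<forall>x\<in>X. \<forall>y. run P x y = f x y"
    using ex_exact_protocol[OF assms(1)] ..
  let ?D = "return_pmf [] :: bool list pmf"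
  have "error_protocol X Y \<delta>1 \<delta>2 f ?D (\<lambda>_. P)"
    using P assms by (simp add: error_protocol_def)
  moreover have "protocol_cost X Y ?D (\<lambda>_. P) \<le> enat (depth P)"
    unfolding protocol_cost_def by (intro SUP_least) (simp add: bits_sent_le_depth)
  then obtain c where "protocol_cost X Y ?D (\<lambda>_. P) = enat c"
    using enat_ile by blast
  ultimately have "\<exists>c D prot. error_protocol X Y \<delta>1 \<delta>2 f D prot \<and> protocol_cost X Y D prot = enat c"
    by (intro exI conjI)
  then show ?thesis
    unfolding rand_comm_def
    by (rule LeastI_ex[of "\<lambda>c. \<exists>D prot. error_protocol X Y \<delta>1 \<delta>2 f D prot \<and>
          protocol_cost X Y D prot = enat c"])
qed

abbreviation bit_strings :: "nat \<Rightarrow> bool list set" where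
  "bit_strings m \<equiv> {s. length s = m}"

(* bits labels the rows and columns of W by bit strings. *)
definition matrix_function :: "('n \<Rightarrow> bool list) \<Rightarrow> real^'n^'n \<Rightarrow> bool list \<Rightarrow> bool list \<Rightarrow> bool" where
  "matrix_function bits W x y \<longleftrightarrow> W $ inv bits x $ inv bits y = 1"


section \<open>Optimal low-rank approximation error\<close>

(* As usual, rank-k means rank at most k.  The minima are written as infima of sets of
   nonnegative reals, as a minimizer need not exist for every entrywise norm. *)
definition low_rank_error :: "(real^'n^'m \<Rightarrow> real) \<Rightarrow> real^'n^'m \<Rightarrow> nat \<Rightarrow> real" where
  "low_rank_error N B k = (INF L\<in>{L. rank L \<le> k}. N (B - L))"

definition masked_low_rank_error ::
  "(real^'n^'m \<Rightarrow> real) \<Rightarrow> real^'n^'m \<Rightarrow> real^'n^'m \<Rightarrow> nat \<Rightarrow> real" where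
  "masked_low_rank_error N A W k = (INF L\<in>{L. rank L \<le> k}. N ((A - L) \<odot> W))"

end

(* Fix the random string r and let M_r be the 0/1 matrix of outputs of the protocol.  Its support
   is a disjoint union of at most 2^c rectangles, c being the cost, so the entrywise product of
   L_opt with M_r has rank at most k * 2^c and competes in the minimum over rank k'.  An entry
   where the protocol is correct contributes to its error exactly what it contributes to OPT; a
   wrong entry contributes one of A or of L_opt instead.  Averaging over r weighs these by eps1
   and eps2.  Finally, masking L by W only decreases entries in absolute value. *)
theory Submission
  imports Defs
begin

lemma rank_add_le:
  fixes A B :: "real^'n^'m"
  shows "rank (A + B) \<le> rank A + rank B"
proof -
  have "range ((*v) (A + B)) \<subseteq> {x + y | x y. x \<in> range ((*v) A) \<and> y \<in> range ((*v) B)}"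
    by (auto simp: matrix_vector_mult_add_rdistrib)
  then have "dim (range ((*v) (A + B)))
      \<le> dim {x + y | x y. x \<in> range ((*v) A) \<and> y \<in> range ((*v) B)}"
    by (rule dim_subset)
  also have "\<dots> \<le> dim (range ((*v) A)) + dim (range ((*v) B))"
    using dim_sums_Int[of "range ((*v) A)" "range ((*v) B)"]
    by (simp add: linear_subspace_image)
  finally show ?thesis
    by (simp add: rank_dim_range)
qed

text \<open>Restricting to a rectangle is multiplication from both sides by 0/1 diagonal matrices,
  and a matrix product never increases rank.\<close>

lemma rank_restrict_le:
  fixes B :: "real^'n^'m"
  shows "rank (\<chi> i j. if i \<in> I \<and> j \<in> J then B $ i $ j else 0) \<le> rank B"
proof -
  let ?D = "(\<chi> i j. if i = j then if i \<in> I then 1 else 0 else 0) :: real^'m^'m"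
  let ?E = "(\<chi> i j. if i = j then if j \<in> J then 1 else 0 else 0) :: real^'n^'n"
  have "?D ** B ** ?E = (\<chi> i j. if i \<in> I \<and> j \<in> J then B $ i $ j else 0)"
    by (simp add: matrix_matrix_mult_def vec_eq_iff mult_delta_left mult_delta_right)
  moreover have "rank (?D ** B ** ?E) \<le> rank B"
    by (meson rank_mul_le_left rank_mul_le_right order_trans)
  ultimately show ?thesis
    by simp
qed

text \<open>The index sets \<open>I\<close> and \<open>J\<close> are the inputs consistent with the transcript so far; the
  bound on the cost is only required there, because unreachable branches of a protocol may be
  arbitrarily deep.\<close>

lemma rank_protocol_le:
  fixes B :: "real^'n^'m" and u :: "'m \<Rightarrow> 'a" and v :: "'n \<Rightarrow> 'b"
  assumes "\<And>i j. i \<in> I \<Longrightarrow> j \<in> J \<Longrightarrow> bits_sent P (u i) (v j) \<le> c"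
  shows "rank (\<chi> i j. if i \<in> I \<and> j \<in> J \<and> run P (u i) (v j) then B $ i $ j else 0)
           \<le> rank B * 2 ^ c"
  using assms
proof (induction P arbitrary: I J c)
  case (Output z)
  \<comment> \<open>A leaf leaves either a single rectangle of \<open>B\<close> or the zero matrix,
    so the factor \<open>2 ^ c\<close> is only slack here.\<close>
  have "rank B * 1 \<le> rank B * 2 ^ c"
    by (intro mult_left_mono) auto
  then show ?case
    using rank_restrict_le[of I J B]
    by (cases z) (auto simp: zero_vec_def[symmetric] intro: order_trans)
next
  case (Alice a P Q)
  let ?M = "\<lambda>P I. \<chi> i j. if i \<in> I \<and> j \<in> J \<and> run P (u i) (v j) then B $ i $ j else 0"
  show ?case
  \<comment> \<open>On an empty rectangle the cost hypothesis is vacuous and \<open>c\<close> may be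
    0; otherwise some input pair sends a bit here, which forces \<open>c = Suc d\<close>.\<close>
  proof (cases "I = {} \<or> J = {}")
    case True
    then show ?thesis by (auto simp: zero_vec_def[symmetric])
  next
    case False
    then obtain d where c: "c = Suc d"
      using Alice.prems by (metis Suc_le_D all_not_in_conv bits_sent.simps(2))
    \<comment> \<open>Alice's bit depends on the row only, so it cuts the rectangle into two with
      the same columns, each with budget \<open>d\<close>.\<close>
    have "?M (Alice a P Q) I = ?M Q {i \<in> I. a (u i)} + ?M P {i \<in> I. \<not> a (u i)}"
      by (auto simp: vec_eq_iff)
    also have "rank \<dots> \<le> rank B * 2 ^ d + rank B * 2 ^ d"
    proof (intro order_trans[OF rank_add_le] add_mono)
      show "rank (?M Q {i \<in> I. a (u i)}) \<le> rank B * 2 ^ d"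
        by (rule Alice.IH) (use Alice.prems c in force)
      show "rank (?M P {i \<in> I. \<not> a (u i)}) \<le> rank B * 2 ^ d"
        by (rule Alice.IH) (use Alice.prems c in force)
    qed
    finally show ?thesis by (simp add: c)
  qed
next
  case (Bob b P Q)
  let ?M = "\<lambda>P J. \<chi> i j. if i \<in> I \<and> j \<in> J \<and> run P (u i) (v j) then B $ i $ j else 0"
  show ?case
  proof (cases "I = {} \<or> J = {}")
    case True
    then show ?thesis by (auto simp: zero_vec_def[symmetric])
  next
    case False
    then obtain d where c: "c = Suc d"
      using Bob.prems by (metis Suc_le_D all_not_in_conv bits_sent.simps(3))
    \<comment> \<open>Symmetrically, Bob's bit cuts the columns.\<close>
    have "?M (Bob b P Q) J = ?M Q {j \<in> J. b (v j)} + ?M P {j \<in> J. \<not> b (v j)}"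
      by (auto simp: vec_eq_iff)
    also have "rank \<dots> \<le> rank B * 2 ^ d + rank B * 2 ^ d"
    proof (intro order_trans[OF rank_add_le] add_mono)
      show "rank (?M Q {j \<in> J. b (v j)}) \<le> rank B * 2 ^ d"
        by (rule Bob.IH) (use Bob.prems c in force)
      show "rank (?M P {j \<in> J. \<not> b (v j)}) \<le> rank B * 2 ^ d"
        by (rule Bob.IH) (use Bob.prems c in force)
    qed
    finally show ?thesis by (simp add: c)
  qed
qed

lemma bits_sent_le_protocol_cost:
  assumes "protocol_cost X Y D prot = enat c" "r \<in> set_pmf D" "x \<in> X" "y \<in> Y"
  shows "bits_sent (prot r) x y \<le> c"
proof -
  have "enat (bits_sent (prot r) x y) \<le> protocol_cost X Y D prot"
    unfolding protocol_cost_def using assms(2-4)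
    by (meson SUP_upper order_trans)
  then show ?thesis
    by (simp add: assms(1))
qed

lemma entrywise_matrix_norm_nonneg: "entrywise_matrix_norm N \<Longrightarrow> 0 \<le> N M"
  by (auto simp: entrywise_matrix_norm_def intro!: sum_nonneg)

text \<open>Nonnegativity of \<open>N\<close> bounds the set below, which a real infimum requires
  before it can be compared with its members.\<close>

lemma low_rank_error_le:
  assumes "entrywise_matrix_norm N" "rank L \<le> k"
  shows "low_rank_error N B k \<le> N (B - L)"
  unfolding low_rank_error_def using assms
  by (intro cINF_lower bdd_belowI[where m = 0]) (auto simp: entrywise_matrix_norm_nonneg)

theorem theorem10:
  fixes A W L L_opt :: "real^'n^'n"
    and N :: "real^'n^'n \<Rightarrow> real"
    and bits :: "'n \<Rightarrow> bool list"
    and m k k' :: nat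
    and \<epsilon>1 \<epsilon>2 \<Delta> :: real
  assumes "CARD('n) = 2 ^ m"
    and "bij_betw bits UNIV (bit_strings m)"
    and "\<And>i j. W $ i $ j \<in> {0, 1}"
    and "k \<ge> 1"
    and "\<epsilon>1 \<in> {0..1}" and "\<epsilon>2 \<in> {0..1}"
    and "k' \<ge> k * 2 ^ rand_comm (bit_strings m) (bit_strings m) \<epsilon>1 \<epsilon>2 (matrix_function bits W)"
    and "\<Delta> \<ge> 0"
    and "entrywise_matrix_norm N"
    and "N (A \<odot> W - L) \<le> low_rank_error N (A \<odot> W) k' + \<Delta>"
    and "rank L_opt \<le> k" and "N ((A - L_opt) \<odot> W) = masked_low_rank_error N A W k"
  shows "N ((A - L) \<odot> W) \<le>
           masked_low_rank_error N A W k + \<epsilon>1 * N (A \<odot> W) + \<epsilon>2 * N (L_opt \<odot> (1 - W)) + \<Delta>"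
proof -
  let ?X = "bit_strings m" and ?f = "matrix_function bits W"
  define c where "c = rand_comm ?X ?X \<epsilon>1 \<epsilon>2 ?f"
  obtain g :: "real \<Rightarrow> real" where g: "mono g" "\<And>t. 0 \<le> g t"
    and N: "\<And>M. N M = (\<Sum>i\<in>UNIV. \<Sum>j\<in>UNIV. g \<bar>M $ i $ j\<bar>)"
    using assms(9) unfolding entrywise_matrix_norm_def by blast
  have "finite ?X"
    using bij_betw_finite[OF assms(2)] by simp
  then obtain D prot where err: "error_protocol ?X ?X \<epsilon>1 \<epsilon>2 ?f D prot"
    and cost: "protocol_cost ?X ?X D prot = enat c"
    using rand_comm_attained assms(5,6) unfolding c_def by (metis atLeastAtMost_iff)
  have bits: "bits i \<in> ?X" "inv bits (bits i) = i" for i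
    using assms(2) by (auto simp: bij_betw_def)
  have f: "?f (bits i) (bits j) \<longleftrightarrow> W $ i $ j = 1" for i j
    by (simp add: matrix_function_def bits)
  define wrong where "wrong i j = {r. run (prot r) (bits i) (bits j) \<noteq> (W $ i $ j = 1)}" for i j
  have prob_wrong: "measure_pmf.prob D (wrong i j) \<le> (if W $ i $ j = 1 then \<epsilon>1 else \<epsilon>2)" for i j
  proof -
    have "measure_pmf.prob D (- wrong i j) \<ge> 1 - (if W $ i $ j = 1 then \<epsilon>1 else \<epsilon>2)"
      using err bits(1)[of i] bits(1)[of j] f[of i j]
      unfolding error_protocol_def wrong_def Collect_neg_eq[symmetric] by auto
    then show ?thesis
      using measure_pmf.prob_compl[of "wrong i j" D] by (simp add: Compl_eq_Diff_UNIV)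
  qed

  define hybrid where
    "hybrid r = (\<chi> i j. if run (prot r) (bits i) (bits j) then L_opt $ i $ j else 0)" for r
  \<comment> \<open>\<open>good\<close> and \<open>bad\<close> are the contributions of an entry of
    \<open>A \<odot> W - hybrid r\<close> when the output is right or wrong. A correct 0 contributes
    \<open>g 0\<close>, which may be positive.\<close>
  define good where
    "good i j = (if W $ i $ j = 1 then g \<bar>A $ i $ j - L_opt $ i $ j\<bar> else g 0)" for i j
  define bad where "bad i j = (if W $ i $ j = 1 then g \<bar>A $ i $ j\<bar> else g \<bar>L_opt $ i $ j\<bar>)" for i j

  have W: "W $ i $ j = 1 \<or> W $ i $ j = 0" for i j
    using assms(3)[of i j] by auto
  \<comment> \<open>This form is affine in the indicators of error, so taking expectations merely
    replaces each indicator by its probability.\<close>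
  have hybrid_norm: "N (A \<odot> W - hybrid r) =
      (\<Sum>i\<in>UNIV. \<Sum>j\<in>UNIV. good i j + indicator (wrong i j) r * (bad i j - good i j))" for r
    unfolding N
  proof (intro sum.cong refl)
    fix i j
    show "g \<bar>(A \<odot> W - hybrid r) $ i $ j\<bar> =
        good i j + indicator (wrong i j) r * (bad i j - good i j)"
      using W[of i j] by (auto simp: hybrid_def good_def bad_def wrong_def)
  qed

  have hybrid_lower: "low_rank_error N (A \<odot> W) k' \<le> N (A \<odot> W - hybrid r)"
    if "r \<in> set_pmf D" for r
  proof (rule low_rank_error_le[OF assms(9)])
    have "rank (hybrid r) \<le> rank L_opt * 2 ^ c"
      using rank_protocol_le[of UNIV UNIV "prot r" bits bits c L_opt]
        bits_sent_le_protocol_cost[OF cost that] bits(1) by (simp add: hybrid_def)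
    also have "\<dots> \<le> k * 2 ^ c"
      using assms(11) by simp
    also have "\<dots> \<le> k'"
      using assms(7) by (simp add: c_def)
    finally show "rank (hybrid r) \<le> k'" .
  qed

  have int: "integrable (measure_pmf D) (indicator S :: _ \<Rightarrow> real)" for S
    by (simp add: less_top[symmetric])
  \<comment> \<open>The lower bound holds for every \<open>r\<close> in the support, hence also for
    the average.\<close>
  have "low_rank_error N (A \<odot> W) k' \<le> measure_pmf.expectation D (\<lambda>r. N (A \<odot> W - hybrid r))"
    by (rule measure_pmf.integral_ge_const)
      (auto simp: hybrid_norm AE_measure_pmf_iff int hybrid_lower[unfolded hybrid_norm])
  also have "\<dots> = (\<Sum>i\<in>UNIV. \<Sum>j\<in>UNIV.
      good i j + measure_pmf.prob D (wrong i j) * (bad i j - good i j))"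
    by (simp add: hybrid_norm int)
  also have "\<dots> \<le> (\<Sum>i\<in>UNIV. \<Sum>j\<in>UNIV. g \<bar>((A - L_opt) \<odot> W) $ i $ j\<bar>
      + \<epsilon>1 * g \<bar>(A \<odot> W) $ i $ j\<bar> + \<epsilon>2 * g \<bar>(L_opt \<odot> (1 - W)) $ i $ j\<bar>)"
  proof (intro sum_mono)
    fix i j
    let ?p = "measure_pmf.prob D (wrong i j)"
    have nonneg: "0 \<le> good i j" "0 \<le> bad i j" "0 \<le> \<epsilon>1" "0 \<le> \<epsilon>2" "0 \<le> g 0"
      using g(2) assms(5,6) by (auto simp: good_def bad_def)
    \<comment> \<open>The saving \<open>?p * good i j\<close> is given up, so that
      \<open>good\<close> accounts for the entry of OPT in full.\<close>
    have "?p * (bad i j - good i j) \<le> ?p * bad i j"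
      using nonneg by (intro mult_left_mono) auto
    also have "\<dots> \<le> (if W $ i $ j = 1 then \<epsilon>1 else \<epsilon>2) * bad i j"
      using prob_wrong nonneg by (intro mult_right_mono)
    finally show "good i j + ?p * (bad i j - good i j) \<le> g \<bar>((A - L_opt) \<odot> W) $ i $ j\<bar>
      + \<epsilon>1 * g \<bar>(A \<odot> W) $ i $ j\<bar> + \<epsilon>2 * g \<bar>(L_opt \<odot> (1 - W)) $ i $ j\<bar>"
      \<comment> \<open>Entries masked to zero on the right still contribute multiples of
        \<open>g 0\<close>; these are nonnegative and only help.\<close>
      using W[of i j]
        mult_nonneg_nonneg[OF nonneg(3,5)] mult_nonneg_nonneg[OF nonneg(4,5)]
      by (elim disjE) (simp_all add: good_def bad_def del: zero_le_mult_iff)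
  qed
  also have "\<dots> = masked_low_rank_error N A W k + \<epsilon>1 * N (A \<odot> W) + \<epsilon>2 * N (L_opt \<odot> (1 - W))"
    unfolding assms(12)[symmetric] N by (simp add: sum.distrib sum_distrib_left)
  finally have "N (A \<odot> W - L) \<le>
      masked_low_rank_error N A W k + \<epsilon>1 * N (A \<odot> W) + \<epsilon>2 * N (L_opt \<odot> (1 - W)) + \<Delta>"
    using assms(10) by linarith
  moreover have "N ((A - L) \<odot> W) \<le> N (A \<odot> W - L)"
    unfolding N
  proof (intro sum_mono)
    fix i j
    \<comment> \<open>Where \<open>W\<close> is 1 both entries agree; where it is 0 the claim is
      \<open>g 0 \<le> g \<bar>L $ i $ j\<bar>\<close>.\<close>
    show "g \<bar>((A - L) \<odot> W) $ i $ j\<bar> \<le> g \<bar>(A \<odot> W - L) $ i $ j\<bar>"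
      using W[of i j] monoD[OF g(1)] by auto
  qed
  ultimately show ?thesis
    by linarith
qed

end
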